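(* Let $N$, $c_n(E)$ and the real parameters be as in the context; in particular $N=-\lambda_1-\alpha_1\in\mathbb{Z}_{\ge 0}$, $\beta<1$, $\alpha_2-\alpha_1<1$, $t_1,t_2>0$, $h_1<h_2$, $l_1<l_2$. Assume that $1+h_2-l_2-\beta>0$ and $2h_2-l_1-l_2-\beta\notin\{-2N,-2N+2,\dots,-4,-2\}$. Set $$p_n(E)=\left(Eq^{2n-1+\lambda_1-h_1-h_2}+q^{-h_2+1/2}\right)\left(Eq^{2n-2+\lambda_1-h_1-h_2}+q^{-h_2+1/2}\right)-q^{4n-1-l_1-l_2-\beta},$$ and $$\tilde c_{N+1}(E)=\prod_{n=1}^{(N+1)/2}p_n(E)\ \text{ if } N \text{ is odd},\qquad \tilde c_{N+1}(E)=\left(Eq^{N+\lambda_1-h_1-h_2}+q^{-h_2+1/2}\right)\prod_{n=1}^{N/2}p_n(E)\ \text{ if } N\text{ is even}.$$ Then $c_{N+1}(E)\approx\tilde c_{N+1}(E)$.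
   Context: Throughout $0<q<1$, and $h_1,h_2,l_1,l_2,\alpha_1,\alpha_2,\beta,t_1,t_2$ are fixed real parameters independent of $q$. Put $\lambda_1=\frac{h_1+h_2-l_1-l_2-\alpha_1-\alpha_2-\beta+2}{2}$. Standing assumption: $N:=-\lambda_1-\alpha_1\in\mathbb{Z}_{\ge 0}$, $\beta<1$, $\alpha_2-\alpha_1<1$, $t_1>0$, $t_2>0$, $h_1<h_2$, $l_1<l_2$. The polynomials $c_n(E)$ in the indeterminate $E$ (of degree $n$, with coefficients depending on $q$) are defined by $c_{-1}(E)=0$, $c_0(E)=1$ and, for $n=1,\dots,N+1$, $$c_n(E)\,t_1t_2\,q^{h_1+h_2}(1-q^n)(1-q^{n-\beta})=c_{n-1}(E)\left[Eq^{n-1+\lambda_1}+q^{1/2}(q^{h_1}t_1+q^{h_2}t_2)+(q^{l_1}t_1+q^{l_2}t_2)q^{2(n+\lambda_1)+\alpha_1+\alpha_2-5/2}\right]-c_{n-2}(E)\,q(1-q^{n-2+\lambda_1+\alpha_1})(1-q^{n-2+\lambda_1+\alpha_2}).$$ The polynomial $c_{N+1}(E)$ is called the spectral polynomial of the $q$-Heun equation. For functions of $q$, $a(q)\approx b(q)$ means that there exists $C>0$ with $\lim_{q\to+0}a(q)/b(q)=C$. For polynomials in $E$ with $q$-dependent coefficients, $\sum_{j=0}^{M}a_j(q)E^j\approx\sum_{j=0}^{M}b_j(q)E^j$ means $a_j(q)\approx b_j(q)$ for every $j=0,\dots,M$ (the constant $C$ may depend on $j$). *)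

theory Defs
  imports Complex_Main "HOL-Computational_Algebra.Polynomial"
begin

definition qheun_lambda1 ::
  "real \<Rightarrow> real \<Rightarrow> real \<Rightarrow> real \<Rightarrow> real \<Rightarrow> real \<Rightarrow> real \<Rightarrow> real"
where
  "qheun_lambda1 h1 h2 l1 l2 \<alpha>1 \<alpha>2 \<beta> = (h1 + h2 - l1 - l2 - \<alpha>1 - \<alpha>2 - \<beta> + 2) / 2"

(* The three coefficients of the recurrence
     lhs n * c_n = mid n * c_{n-1} - low n * c_{n-2};
   qheun_mid is the square bracket, a polynomial of degree 1 in E. *)

definition qheun_lhs ::
  "real \<Rightarrow> real \<Rightarrow> real \<Rightarrow> real \<Rightarrow> real \<Rightarrow> real \<Rightarrow> nat \<Rightarrow> real"
where
  "qheun_lhs h1 h2 \<beta> t1 t2 q n =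
     t1 * t2 * q powr (h1 + h2) * (1 - q ^ n) * (1 - q powr (real n - \<beta>))"

definition qheun_mid ::
  "real \<Rightarrow> real \<Rightarrow> real \<Rightarrow> real \<Rightarrow> real \<Rightarrow> real \<Rightarrow> real \<Rightarrow> real \<Rightarrow> real \<Rightarrow> real
    \<Rightarrow> nat \<Rightarrow> real poly"
where
  "qheun_mid h1 h2 l1 l2 \<alpha>1 \<alpha>2 \<beta> t1 t2 q n =
     (let lam1 = qheun_lambda1 h1 h2 l1 l2 \<alpha>1 \<alpha>2 \<beta> in
      [: q powr (1 / 2) * (q powr h1 * t1 + q powr h2 * t2)
           + (q powr l1 * t1 + q powr l2 * t2)
               * q powr (2 * (real n + lam1) + \<alpha>1 + \<alpha>2 - 5 / 2),
         q powr (real n - 1 + lam1) :])"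

definition qheun_low ::
  "real \<Rightarrow> real \<Rightarrow> real \<Rightarrow> real \<Rightarrow> real \<Rightarrow> real \<Rightarrow> real \<Rightarrow> real \<Rightarrow> nat \<Rightarrow> real"
where
  "qheun_low h1 h2 l1 l2 \<alpha>1 \<alpha>2 \<beta> q n =
     (let lam1 = qheun_lambda1 h1 h2 l1 l2 \<alpha>1 \<alpha>2 \<beta> in
      q * (1 - q powr (real n - 2 + lam1 + \<alpha>1)) * (1 - q powr (real n - 2 + lam1 + \<alpha>2)))"

(* The recurrence solved for c_n, as a polynomial in E; the equation for n = 1 incorporates
   c_{-1} = 0.  The lemma qheun_c_recurrence below gives the original, division-free form. *)

fun qheun_c ::
  "real \<Rightarrow> real \<Rightarrow> real \<Rightarrow> real \<Rightarrow> real \<Rightarrow> real \<Rightarrow> real \<Rightarrow> real \<Rightarrow> real \<Rightarrow> real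
    \<Rightarrow> nat \<Rightarrow> real poly"
where
  "qheun_c h1 h2 l1 l2 \<alpha>1 \<alpha>2 \<beta> t1 t2 q 0 = 1"
| "qheun_c h1 h2 l1 l2 \<alpha>1 \<alpha>2 \<beta> t1 t2 q (Suc 0) =
     smult (1 / qheun_lhs h1 h2 \<beta> t1 t2 q 1) (qheun_mid h1 h2 l1 l2 \<alpha>1 \<alpha>2 \<beta> t1 t2 q 1)"
| "qheun_c h1 h2 l1 l2 \<alpha>1 \<alpha>2 \<beta> t1 t2 q (Suc (Suc n)) =
     smult (1 / qheun_lhs h1 h2 \<beta> t1 t2 q (n + 2))
       (qheun_c h1 h2 l1 l2 \<alpha>1 \<alpha>2 \<beta> t1 t2 q (Suc n)
          * qheun_mid h1 h2 l1 l2 \<alpha>1 \<alpha>2 \<beta> t1 t2 q (n + 2)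
        - smult (qheun_low h1 h2 l1 l2 \<alpha>1 \<alpha>2 \<beta> q (n + 2))
            (qheun_c h1 h2 l1 l2 \<alpha>1 \<alpha>2 \<beta> t1 t2 q n))"

lemma qheun_lhs_nonzero:
  assumes "0 < q" "q < 1" "\<beta> < 1" "t1 > 0" "t2 > 0" "n \<ge> 1"
  shows "qheun_lhs h1 h2 \<beta> t1 t2 q n \<noteq> 0"
proof -
  have "q ^ n < 1"
    using assms by (simp add: power_less_one_iff)
  moreover have "q powr (real n - \<beta>) < 1"
    using assms powr_less_mono'[of q 0 "real n - \<beta>"] by simp
  ultimately show ?thesis
    using assms by (simp add: qheun_lhs_def)
qed

lemma qheun_c_recurrence:
  assumes "0 < q" "q < 1" "\<beta> < 1" "t1 > 0" "t2 > 0" "n \<ge> 1"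
    and "lam1 = qheun_lambda1 h1 h2 l1 l2 \<alpha>1 \<alpha>2 \<beta>"
    and "c = qheun_c h1 h2 l1 l2 \<alpha>1 \<alpha>2 \<beta> t1 t2 q"
  shows "poly (c n) E * t1 * t2 * q powr (h1 + h2) * (1 - q ^ n) * (1 - q powr (real n - \<beta>)) =
     poly (c (n - 1)) E *
       (E * q powr (real n - 1 + lam1)
        + q powr (1 / 2) * (q powr h1 * t1 + q powr h2 * t2)
        + (q powr l1 * t1 + q powr l2 * t2)
            * q powr (2 * (real n + lam1) + \<alpha>1 + \<alpha>2 - 5 / 2))
     - (if n = 1 then 0 else poly (c (n - 2)) E)
         * (q * (1 - q powr (real n - 2 + lam1 + \<alpha>1)) * (1 - q powr (real n - 2 + lam1 + \<alpha>2)))"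
proof -
  define D where "D = qheun_lhs h1 h2 \<beta> t1 t2 q n"
  have D: "D \<noteq> 0" unfolding D_def by (rule qheun_lhs_nonzero) fact+
  have "poly (c n) E * D =
     poly (c (n - 1)) E * poly (qheun_mid h1 h2 l1 l2 \<alpha>1 \<alpha>2 \<beta> t1 t2 q n) E
     - (if n = 1 then 0 else poly (c (n - 2)) E) * qheun_low h1 h2 l1 l2 \<alpha>1 \<alpha>2 \<beta> q n"
  proof (cases "n = 1")
    case True
    then show ?thesis using D by (simp add: assms(8) D_def)
  next
    case False
    then obtain m where "n = Suc (Suc m)"
      using assms(6) by (cases n; cases "n - 1") auto
    then show ?thesis using D by (simp add: assms(8) D_def)
  qed
  then show ?thesis
    by (simp add: D_def qheun_lhs_def qheun_mid_def qheun_low_def Let_def assms(7) ac_simps)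
qed

definition qheun_p ::
  "real \<Rightarrow> real \<Rightarrow> real \<Rightarrow> real \<Rightarrow> real \<Rightarrow> real \<Rightarrow> real \<Rightarrow> real \<Rightarrow> nat \<Rightarrow> real poly"
where
  "qheun_p h1 h2 l1 l2 \<alpha>1 \<alpha>2 \<beta> q n =
     (let lam1 = qheun_lambda1 h1 h2 l1 l2 \<alpha>1 \<alpha>2 \<beta> in
      [: q powr (- h2 + 1 / 2), q powr (2 * real n - 1 + lam1 - h1 - h2) :]
      * [: q powr (- h2 + 1 / 2), q powr (2 * real n - 2 + lam1 - h1 - h2) :]
      - [: q powr (4 * real n - 1 - l1 - l2 - \<beta>) :])"

(* qheun_c_tilde ... q N is the polynomial with index N + 1. *)

definition qheun_c_tilde ::
  "real \<Rightarrow> real \<Rightarrow> real \<Rightarrow> real \<Rightarrow> real \<Rightarrow> real \<Rightarrow> real \<Rightarrow> real \<Rightarrow> nat \<Rightarrow> real poly"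
where
  "qheun_c_tilde h1 h2 l1 l2 \<alpha>1 \<alpha>2 \<beta> q N =
     (let lam1 = qheun_lambda1 h1 h2 l1 l2 \<alpha>1 \<alpha>2 \<beta> in
      if odd N
      then \<Prod>n=1..(N + 1) div 2. qheun_p h1 h2 l1 l2 \<alpha>1 \<alpha>2 \<beta> q n
      else [: q powr (- h2 + 1 / 2), q powr (real N + lam1 - h1 - h2) :]
           * (\<Prod>n=1..N div 2. qheun_p h1 h2 l1 l2 \<alpha>1 \<alpha>2 \<beta> q n))"

(* Since C > 0 and x / 0 = 0, the limit forces b to be nonzero near 0. *)

definition q_approx :: "(real \<Rightarrow> real) \<Rightarrow> (real \<Rightarrow> real) \<Rightarrow> bool"
where
  "q_approx a b \<longleftrightarrow> (\<exists>C>0. ((\<lambda>q. a q / b q) \<longlongrightarrow> C) (at_right 0))"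

(* Both sides are written as sums over j = 0, ..., M, so M is part of the relation: it bounds the
   degrees, and every coefficient up to M is compared. *)

definition q_approx_poly :: "nat \<Rightarrow> (real \<Rightarrow> real poly) \<Rightarrow> (real \<Rightarrow> real poly) \<Rightarrow> bool"
where
  "q_approx_poly M a b \<longleftrightarrow>
     (\<forall>q\<in>{0<..<1}. degree (a q) \<le> M \<and> degree (b q) \<le> M) \<and>
     (\<forall>j\<le>M. q_approx (\<lambda>q. coeff (a q) j) (\<lambda>q. coeff (b q) j))"

end

theory Submission
  imports Defs
begin

text \<open>Divided by the leading coefficient, the recurrence reads
  \<open>c n = (A n * E + B n) * c (n - 1) - C n * c (n - 2)\<close>, where \<open>A n\<close>, \<open>B n\<close>, \<open>C n\<close> are
  positive constants times powers of \<open>q\<close> of exponents \<open>v + n\<close>, \<open>u\<close>, \<open>2 * n + w\<close>, up to a factor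
  \<open>1 + o(1)\<close>. The polynomials with tilde satisfy the same recurrence with exact powers and with
  \<open>C n\<close> replaced by \<open>0\<close> for odd \<open>n\<close>. Expand the continuant and group the terms of the coefficient
  of \<open>E ^ j\<close> by the number \<open>m\<close> of factors \<open>C\<close>: each group has sign \<open>(-1) ^ m\<close> and its least
  exponent is the same in both cases, because an optimal term can use only even-indexed \<open>C\<close>.
  By the hypothesis on \<open>2 * h2 - l1 - l2 - \<beta>\<close> different \<open>m\<close> give different exponents, so exactly one
  group dominates and nothing cancels.\<close>

section \<open>Power asymptotics at zero\<close>

definition pow_asymp :: "(real \<Rightarrow> real) \<Rightarrow> real \<Rightarrow> real \<Rightarrow> bool" where
  "pow_asymp f e a \<longleftrightarrow> ((\<lambda>q. f q / q powr e) \<longlongrightarrow> a) (at_right 0)"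

lemma eventually_at_right_0: "(\<And>q::real. 0 < q \<Longrightarrow> P q) \<Longrightarrow> eventually P (at_right 0)"
  by (rule eventually_mono[OF eventually_at_right_less]) auto

lemma powr_tendsto_0_at_right:
  assumes "0 < (e::real)"
  shows "((\<lambda>q. q powr e) \<longlongrightarrow> 0) (at_right 0)"
proof -
  have "((\<lambda>q::real. q powr e) \<longlongrightarrow> 0 powr e) (at_right 0)"
    by (rule tendsto_powr'[OF tendsto_ident_at tendsto_const])
       (use assms in \<open>auto intro!: eventually_at_right_0\<close>)
  then show ?thesis by simp
qed

lemma pow_asymp_zero [simp]: "pow_asymp (\<lambda>q. 0) e 0"
  by (simp add: pow_asymp_def)

lemma pow_asymp_powr: "pow_asymp (\<lambda>q. q powr e) e 1"
  unfolding pow_asymp_def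
  by (rule tendsto_eventually) (rule eventually_at_right_0, simp)

lemma pow_asymp_const: "pow_asymp (\<lambda>q. c) 0 c"
  unfolding pow_asymp_def
  by (rule tendsto_eventually) (rule eventually_at_right_0, simp)

lemma pow_asymp_mult:
  "pow_asymp f d a \<Longrightarrow> pow_asymp g e b \<Longrightarrow> pow_asymp (\<lambda>q. f q * g q) (d + e) (a * b)"
  unfolding pow_asymp_def powr_add times_divide_times_eq[symmetric] by (rule tendsto_mult)

lemma pow_asymp_divide:
  assumes "pow_asymp f d a" "pow_asymp g e b" "b \<noteq> 0"
  shows "pow_asymp (\<lambda>q. f q / g q) (d - e) (a / b)"
proof -
  have "((\<lambda>q. (f q / q powr d) / (g q / q powr e)) \<longlongrightarrow> a / b) (at_right 0)"
    using assms unfolding pow_asymp_def by (intro tendsto_divide)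
  then show ?thesis
    unfolding pow_asymp_def powr_diff by (simp add: divide_simps mult_ac)
qed

lemma pow_asymp_add:
  "pow_asymp f e a \<Longrightarrow> pow_asymp g e b \<Longrightarrow> pow_asymp (\<lambda>q. f q + g q) e (a + b)"
  unfolding pow_asymp_def add_divide_distrib by (rule tendsto_add)

lemma pow_asymp_cmult: "pow_asymp f e a \<Longrightarrow> pow_asymp (\<lambda>q. c * f q) e (c * a)"
  using pow_asymp_mult[OF pow_asymp_const] by fastforce

lemma pow_asymp_sum:
  "(\<And>i. i \<in> I \<Longrightarrow> pow_asymp (f i) e (a i)) \<Longrightarrow> pow_asymp (\<lambda>q. \<Sum>i\<in>I. f i q) e (\<Sum>i\<in>I. a i)"
  unfolding pow_asymp_def sum_divide_distrib by (rule tendsto_sum)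

text \<open>This brings terms of different orders to one exponent, where sums can be taken; terms of
  strictly higher order acquire limit 0.\<close>

lemma pow_asymp_lower:
  assumes "pow_asymp f e a" "d \<le> e"
  shows "pow_asymp f d (if d = e then a else 0)"
proof (cases "d = e")
  case False
  with assms have "((\<lambda>q. (f q / q powr e) * q powr (e - d)) \<longlongrightarrow> a * 0) (at_right 0)"
    unfolding pow_asymp_def by (intro tendsto_mult powr_tendsto_0_at_right) auto
  moreover have "\<forall>\<^sub>F q in at_right 0. (f q / q powr e) * q powr (e - d) = f q / q powr d"
    by (rule eventually_at_right_0) (simp add: powr_diff)
  ultimately show ?thesis
    using False by (simp add: pow_asymp_def tendsto_cong)
qed (use assms in simp)

lemma pow_asymp_add_dominant:
  "pow_asymp f e a \<Longrightarrow> pow_asymp g d b \<Longrightarrow> e < d \<Longrightarrow> pow_asymp (\<lambda>q. f q + g q) e a"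
  using pow_asymp_add[OF _ pow_asymp_lower[of g d b e]] by fastforce

lemma pow_asymp_one_minus_powr_pos: "0 < e \<Longrightarrow> pow_asymp (\<lambda>q. 1 - q powr e) 0 1"
  using pow_asymp_add_dominant[OF pow_asymp_const pow_asymp_cmult[OF pow_asymp_powr], of e 1 "-1"]
  by simp

lemma pow_asymp_one_minus_powr_neg: "e < 0 \<Longrightarrow> pow_asymp (\<lambda>q. 1 - q powr e) e (-1)"
  using pow_asymp_add_dominant[OF pow_asymp_cmult[OF pow_asymp_powr] pow_asymp_const, of e "-1" 1]
  by simp

text \<open>Positive \<open>q\<close> suffice because the limit is one-sided. The premises
  \<open>e = d\<close> and \<open>a = b\<close> allow exponents and limits built up by the product
  rules to be normalised afterwards.\<close>

lemma pow_asymp_cong: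
  assumes "pow_asymp f e a" "\<And>q. 0 < q \<Longrightarrow> f q = g q" "e = d" "a = b"
  shows "pow_asymp g d b"
proof -
  have "\<forall>\<^sub>F q in at_right 0. f q / q powr e = g q / q powr e"
    by (rule eventually_at_right_0) (simp add: assms(2))
  from tendsto_cong[OF this, of a] assms show ?thesis by (simp add: pow_asymp_def)
qed

text \<open>The powers of \<open>q\<close> cancel in the quotient. Both limits may be negative, and
  \<open>0 < a / b\<close> rules out \<open>b = 0\<close>.\<close>

lemma q_approx_pow_asymp:
  assumes "pow_asymp f e a" "pow_asymp g e b" "0 < a / b"
  shows "q_approx f g"
proof -
  have div: "pow_asymp (\<lambda>q. f q / g q) (e - e) (a / b)"
    using assms by (intro pow_asymp_divide) auto
  have "\<forall>\<^sub>F q in at_right 0. f q / g q / q powr 0 = f q / g q"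
    by (rule eventually_at_right_0) simp
  from tendsto_cong[OF this, of "a / b"] div assms(3) show ?thesis
    unfolding q_approx_def pow_asymp_def by auto
qed

section \<open>Continuants\<close>

text \<open>This is the determinant of the tridiagonal matrix with diagonal entries
  \<open>B k + A k * E\<close>, where \<open>C k\<close> is the product of the two off-diagonal
  entries linking \<open>k - 1\<close> and \<open>k\<close>.\<close>

fun continuant :: "(nat \<Rightarrow> real) \<Rightarrow> (nat \<Rightarrow> real) \<Rightarrow> (nat \<Rightarrow> real) \<Rightarrow> nat \<Rightarrow> real poly" where
  "continuant A B C 0 = 1"
| "continuant A B C (Suc 0) = [:B 1, A 1:]"
| "continuant A B C (Suc (Suc n)) =
     continuant A B C (Suc n) * [:B (n + 2), A (n + 2):] - smult (C (n + 2)) (continuant A B C n)"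

text \<open>The part of the continuant that uses exactly \<open>m\<close> of the factors \<open>C\<close>, without its sign
  \<open>(-1) ^ m\<close>.\<close>

fun continuant_part ::
  "(nat \<Rightarrow> real) \<Rightarrow> (nat \<Rightarrow> real) \<Rightarrow> (nat \<Rightarrow> real) \<Rightarrow> nat \<Rightarrow> nat \<Rightarrow> real poly" where
  "continuant_part A B C 0 m = (if m = 0 then 1 else 0)"
| "continuant_part A B C (Suc 0) m = (if m = 0 then [:B 1, A 1:] else 0)"
| "continuant_part A B C (Suc (Suc n)) m =
     continuant_part A B C (Suc n) m * [:B (n + 2), A (n + 2):]
     + (case m of 0 \<Rightarrow> 0 | Suc i \<Rightarrow> smult (C (n + 2)) (continuant_part A B C n i))"

lemma coeff_mult_linear:
  fixes p :: "'a :: comm_ring_1 poly"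
  shows "coeff (p * [:b, a:]) j = b * coeff p j + (case j of 0 \<Rightarrow> 0 | Suc i \<Rightarrow> a * coeff p i)"
  by (cases j) simp_all

lemma degree_continuant: "degree (continuant A B C n) \<le> n"
proof (induction n rule: continuant.induct)
  case (3 A B C n)
  have "degree (continuant A B C (Suc n) * [:B (n + 2), A (n + 2):]) \<le> Suc n + 1"
    by (rule order_trans[OF degree_mult_le]) (use 3 in \<open>intro add_mono; simp\<close>)
  moreover have "degree (smult (C (n + 2)) (continuant A B C n)) \<le> Suc n + 1"
    using 3(2) by (intro order_trans[OF degree_smult_le]) simp
  ultimately show ?case by (simp add: degree_diff_le)
qed simp_all

text \<open>Each factor \<open>A k\<close> takes one index and each factor \<open>C k\<close> the
  two indices \<open>k - 1\<close> and \<open>k\<close>, so a term needs \<open>j + 2 * m\<close>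
  indices.\<close>

lemma coeff_continuant_part_eq_0:
  "n < j + 2 * m \<Longrightarrow> coeff (continuant_part A B C n m) j = 0"
proof (induction A B C n m arbitrary: j rule: continuant_part.induct)
  case (2 A B C m)
  then show ?case by (auto simp: coeff_pCons split: nat.split)
next
  case (3 A B C n m)
  then show ?case by (cases m; cases j) (simp_all add: coeff_mult_linear)
qed auto

text \<open>The bound \<open>M\<close> is left free because the induction step needs
  \<open>M\<close> itself for \<open>Suc n\<close> but \<open>M - 1\<close> for
  \<open>n\<close>.\<close>

lemma continuant_eq_sum_parts:
  "n \<le> M \<Longrightarrow> continuant A B C n = (\<Sum>m\<le>M. smult ((-1) ^ m) (continuant_part A B C n m))"
proof (induction n arbitrary: M rule: continuant.induct)
  case (1 A B C)
  have "(\<Sum>m\<le>M. smult ((-1) ^ m) (continuant_part A B C 0 m)) = (\<Sum>m\<le>M. if m = 0 then 1 else 0)"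
    by (rule sum.cong) auto
  then show ?case by simp
next
  case (2 A B C)
  have "(\<Sum>m\<le>M. smult ((-1) ^ m) (continuant_part A B C (Suc 0) m))
      = (\<Sum>m\<le>M. if m = 0 then [:B 1, A 1:] else 0)"
    by (rule sum.cong) auto
  then show ?case by simp
next
  case (3 A B C n)
  then obtain M' where M: "M = Suc M'" "n \<le> M'" by (cases M) auto
  \<comment> \<open>The summand for \<open>m = 0\<close> vanishes; the index shift turns
    \<open>(-1) ^ Suc i\<close> into the minus sign of the recurrence.\<close>
  have "(\<Sum>m\<le>M. smult ((-1) ^ m) (case m of 0 \<Rightarrow> 0
           | Suc i \<Rightarrow> smult (C (n + 2)) (continuant_part A B C n i)))
      = - smult (C (n + 2)) (\<Sum>m\<le>M'. smult ((-1) ^ m) (continuant_part A B C n m))"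
    unfolding M(1) sum.atMost_Suc_shift
    by (rule poly_eqI) (simp add: coeff_sum sum_distrib_left sum_negf ac_simps)
  moreover have "continuant A B C (Suc n) * [:B (n + 2), A (n + 2):]
      = (\<Sum>m\<le>M. smult ((-1) ^ m) (continuant_part A B C (Suc n) m * [:B (n + 2), A (n + 2):]))"
    using "3.IH"(1)[OF Suc_leD[OF "3.prems"]] by (simp only: sum_distrib_right mult_smult_left)
  ultimately show ?case
    using "3.IH"(2)[OF M(2)]
    by (simp only: continuant.simps continuant_part.simps smult_add_right sum.distrib diff_conv_add_uminus)
qed

section \<open>Asymptotics of the coefficients of a continuant\<close>

text \<open>An optimal term of the part with \<open>m\<close> factors \<open>C\<close> in degree \<open>j\<close> occupies the indices
  \<open>1, \<dots>, j + 2 * m\<close> with its factors \<open>A\<close> and \<open>C\<close>; a factor \<open>C k\<close>, of order \<open>2 * k + w\<close>, counts as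
  \<open>(k - 1) + k + (w + 1)\<close>.\<close>

definition cexp :: "real \<Rightarrow> real \<Rightarrow> real \<Rightarrow> nat \<Rightarrow> nat \<Rightarrow> nat \<Rightarrow> real" where
  "cexp v u w n j m = real j * v + (real n - real j - 2 * real m) * u + real m * (w + 1)
     + (real j + 2 * real m) * (real j + 2 * real m + 1) / 2"

text \<open>Without signs all limits are nonnegative, so nothing cancels: each of the three summands
  of the recurrence has at least the claimed order, and one attains it with a positive limit.
  Admitting limit 0 for \<open>C\<close> at odd indices covers both polynomials at once.\<close>

lemma coeff_continuant_part_asymp:
  fixes A B C :: "real \<Rightarrow> nat \<Rightarrow> real" and u v w :: real
  assumes A: "\<And>n. n \<in> {1..M} \<Longrightarrow> \<exists>a>0. pow_asymp (\<lambda>q. A q n) (v + n) a"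
    and B: "\<And>n. n \<in> {1..M} \<Longrightarrow> \<exists>b>0. pow_asymp (\<lambda>q. B q n) u b"
    and C: "\<And>n. n \<in> {2..M} \<Longrightarrow> \<exists>c\<ge>0. (even n \<longrightarrow> c > 0) \<and> pow_asymp (\<lambda>q. C q n) (2 * real n + w) c"
    and "n \<le> M" "j + 2 * m \<le> n"
  shows "\<exists>t>0. pow_asymp (\<lambda>q. coeff (continuant_part (A q) (B q) (C q) n m) j) (cexp v u w n j m) t"
  using assms(4,5)
proof (induction n arbitrary: j m rule: less_induct)
  case (less k)
  let ?P = "\<lambda>q. continuant_part (A q) (B q) (C q)"
  consider "k = 0" | "k = 1" | n where "k = Suc (Suc n)"
    by (cases k; cases "k - 1") auto
  then show ?case
  proof cases
    case 1
    with less.prems have "j = 0" "m = 0" by auto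
    with 1 show ?thesis
      using pow_asymp_const[of 1] by (auto simp: cexp_def intro!: exI[of _ 1])
  next
    case 2
    with less.prems have m: "m = 0" and j: "j = 0 \<or> j = 1" by auto
    from 2 less.prems obtain a b where "a > 0" "pow_asymp (\<lambda>q. A q 1) (v + 1) a"
      "b > 0" "pow_asymp (\<lambda>q. B q 1) u b"
      using A[of 1] B[of 1] by auto
    from j show ?thesis
    proof
      assume "j = 0"
      with \<open>b > 0\<close> \<open>pow_asymp _ u b\<close> show ?thesis
        by (intro exI[of _ b]) (simp add: 2 m cexp_def)
    next
      assume "j = 1"
      with \<open>a > 0\<close> \<open>pow_asymp _ (v + 1) a\<close> show ?thesis
        by (intro exI[of _ a]) (simp add: 2 m cexp_def)
    qed
  next
    case (3 n)
    \<comment> \<open>Limit 0 stands for the parts that vanish identically, so the three summands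
      need no case distinction on whether the degree is attainable.\<close>
    have IH: "\<exists>t\<ge>0. (j + 2 * m \<le> i \<longrightarrow> t > 0) \<and> pow_asymp (\<lambda>q. coeff (?P q i m) j) (cexp v u w i j m) t"
      if i: "i < k" for i j m
    proof (cases "j + 2 * m \<le> i")
      case True
      then obtain t where "t > 0"
        "pow_asymp (\<lambda>q. coeff (?P q i m) j) (cexp v u w i j m) t"
        using less.IH[of i j m] i less.prems(1) by auto
      then show ?thesis by (intro exI[of _ t]) simp
    next
      case False
      then show ?thesis by (intro exI[of _ 0]) (simp add: coeff_continuant_part_eq_0)
    qed
    let ?e = "cexp v u w k j m"
    have le: "real (j + 2 * m) \<le> real k" using less.prems by (simp only: of_nat_le_iff)
    have "\<exists>t\<ge>0. (j + 2 * m \<le> Suc n \<longrightarrow> t > 0) \<and>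
            pow_asymp (\<lambda>q. B q k * coeff (?P q (Suc n) m) j) ?e t" (is "\<exists>t\<ge>0. ?X t")
    proof -
      obtain b where b: "b > 0" "pow_asymp (\<lambda>q. B q k) u b"
        using B[of k] 3 less.prems by auto
      obtain t where t: "t \<ge> 0" "j + 2 * m \<le> Suc n \<longrightarrow> t > 0"
        "pow_asymp (\<lambda>q. coeff (?P q (Suc n) m) j) (cexp v u w (Suc n) j m) t"
        using IH[of "Suc n" j m] 3 by auto
      have "pow_asymp (\<lambda>q. B q k * coeff (?P q (Suc n) m) j) ?e (b * t)"
        by (rule pow_asymp_cong[OF pow_asymp_mult[OF b(2) t(3)]])
           (simp_all add: cexp_def 3 field_simps)
      with b t show ?thesis by (intro exI[of _ "b * t"]) auto
    qed
    then obtain tB where tB: "tB \<ge> 0" "?X tB" by blast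
    have "\<exists>t\<ge>0. (j + 2 * m = k \<longrightarrow> j \<noteq> 0 \<longrightarrow> t > 0) \<and>
            pow_asymp (\<lambda>q. case j of 0 \<Rightarrow> 0 | Suc i \<Rightarrow> A q k * coeff (?P q (Suc n) m) i) ?e t"
      (is "\<exists>t\<ge>0. ?Y t")
    proof (cases j)
      case (Suc i)
      obtain a where a: "a > 0" "pow_asymp (\<lambda>q. A q k) (v + k) a"
        using A[of k] 3 less.prems by auto
      obtain t where t: "t \<ge> 0" "i + 2 * m \<le> Suc n \<longrightarrow> t > 0"
        "pow_asymp (\<lambda>q. coeff (?P q (Suc n) m) i) (cexp v u w (Suc n) i m) t"
        using IH[of "Suc n" i m] 3 by auto
      let ?e' = "v + k + cexp v u w (Suc n) i m"
      \<comment> \<open>The excess is the cost of a factor \<open>A\<close> at index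
        \<open>k\<close> when \<open>j + 2 * m\<close> indices suffice; it vanishes exactly for
        \<open>j + 2 * m = k\<close>.\<close>
      have e': "?e' = ?e + (real k - real (j + 2 * m))"
        by (simp add: cexp_def 3 Suc field_simps)
      have "pow_asymp (\<lambda>q. A q k * coeff (?P q (Suc n) m) i) ?e (if ?e = ?e' then a * t else 0)"
        by (rule pow_asymp_lower[OF pow_asymp_mult[OF a(2) t(3)]])
           (use e' le in linarith)
      with a t e' show ?thesis
        by (intro exI[of _ "if ?e = ?e' then a * t else 0"]) (auto simp: 3 Suc)
    qed auto
    then obtain tA where tA: "tA \<ge> 0" "?Y tA" by blast
    have "\<exists>t\<ge>0. (j + 2 * m = k \<longrightarrow> j = 0 \<longrightarrow> t > 0) \<and>
            pow_asymp (\<lambda>q. case m of 0 \<Rightarrow> 0 | Suc i \<Rightarrow> C q k * coeff (?P q n i) j) ?e t"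
      (is "\<exists>t\<ge>0. ?Z t")
    proof (cases m)
      case 0
      then show ?thesis using 3 by auto
    next
      case (Suc i)
      obtain c where c: "c \<ge> 0" "even k \<longrightarrow> c > 0" "pow_asymp (\<lambda>q. C q k) (2 * real k + w) c"
        using C[of k] 3 less.prems by auto
      obtain t where t: "t \<ge> 0" "j + 2 * i \<le> n \<longrightarrow> t > 0"
        "pow_asymp (\<lambda>q. coeff (?P q n i) j) (cexp v u w n j i) t"
        using IH[of n j i] 3 by auto
      let ?e' = "2 * real k + w + cexp v u w n j i"
      \<comment> \<open>The excess is doubled because \<open>C\<close> moves two indices,
        \<open>k - 1\<close> and \<open>k\<close>.\<close>
      have e': "?e' = ?e + 2 * (real k - real (j + 2 * m))"
        by (simp add: cexp_def 3 Suc field_simps)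
      have le': "?e \<le> ?e'" unfolding e' using le by simp
      have "pow_asymp (\<lambda>q. C q k * coeff (?P q n i) j) ?e (if ?e = ?e' then c * t else 0)"
        by (rule pow_asymp_lower[OF pow_asymp_mult[OF c(3) t(3)]])
           (rule le')
      \<comment> \<open>Here \<open>k = 2 * m\<close> is even, so \<open>c\<close> is
        positive.\<close>
      moreover have "?e = ?e' \<and> c * t > 0" if "j + 2 * m = k" "j = 0"
        using that c t e' 3 Suc by auto
      ultimately show ?thesis using c(1) t(1)
        by (intro exI[of _ "if ?e = ?e' then c * t else 0"]) (simp add: Suc)
    qed
    then obtain tC where tC: "tC \<ge> 0" "?Z tC" by blast
    have "pow_asymp (\<lambda>q. coeff (?P q k m) j) ?e (tB + tA + tC)"
    proof (rule pow_asymp_cong[OF pow_asymp_add[OF pow_asymp_add]])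
      show "pow_asymp (\<lambda>q. B q k * coeff (?P q (Suc n) m) j) ?e tB" using tB by simp
      show "pow_asymp (\<lambda>q. case j of 0 \<Rightarrow> 0 | Suc i \<Rightarrow> A q k * coeff (?P q (Suc n) m) i) ?e tA"
        using tA by simp
      show "pow_asymp (\<lambda>q. case m of 0 \<Rightarrow> 0 | Suc i \<Rightarrow> C q k * coeff (?P q n i) j) ?e tC"
        using tC by simp
    qed (auto simp: 3 coeff_mult_linear split: nat.split)
    moreover have "tB + tA + tC > 0"
    proof -
      \<comment> \<open>If an index is left over, the summand with \<open>B\<close> is positive.
        Otherwise the last index carries \<open>A\<close> in some optimal term when \<open>j\<close>
        is nonzero, and \<open>C\<close> when \<open>j = 0\<close>.\<close>
      consider "j + 2 * m \<le> Suc n" | "j + 2 * m = k" "j \<noteq> 0" | "j + 2 * m = k" "j = 0"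
        using less.prems 3 by linarith
      then show ?thesis by cases (use tA tB tC in auto)
    qed
    ultimately show ?thesis by blast
  qed
qed

text \<open>At the strictly least exponent all other parts have limit 0, so the alternating signs
  cannot cause cancellation.\<close>

lemma coeff_continuant_asymp:
  fixes A B C :: "real \<Rightarrow> nat \<Rightarrow> real" and u v w :: real
  assumes "\<And>k. k \<in> {1..n} \<Longrightarrow> \<exists>a>0. pow_asymp (\<lambda>q. A q k) (v + k) a"
    and "\<And>k. k \<in> {1..n} \<Longrightarrow> \<exists>b>0. pow_asymp (\<lambda>q. B q k) u b"
    and "\<And>k. k \<in> {2..n} \<Longrightarrow> \<exists>c\<ge>0. (even k \<longrightarrow> c > 0) \<and> pow_asymp (\<lambda>q. C q k) (2 * real k + w) c"
    and m: "j + 2 * m \<le> n"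
    and min: "\<And>i. j + 2 * i \<le> n \<Longrightarrow> i \<noteq> m \<Longrightarrow> cexp v u w n j m < cexp v u w n j i"
  shows "\<exists>t>0. pow_asymp (\<lambda>q. coeff (continuant (A q) (B q) (C q) n) j)
                 (cexp v u w n j m) ((-1) ^ m * t)"
proof -
  let ?e = "cexp v u w n j m"
  let ?f = "\<lambda>i q. (-1) ^ i * coeff (continuant_part (A q) (B q) (C q) n i) j"
  obtain t where t: "t > 0"
    "pow_asymp (\<lambda>q. coeff (continuant_part (A q) (B q) (C q) n m) j) ?e t"
    using coeff_continuant_part_asymp[of n A v B u C w n j m] assms by blast
  have "pow_asymp (?f i) ?e (if i = m then (-1) ^ m * t else 0)" for i
  proof (cases "i = m")
    case True
    then show ?thesis using pow_asymp_cmult[OF t(2)] by simp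
  next
    case False
    show ?thesis
    proof (cases "j + 2 * i \<le> n")
      case True
      obtain s where "pow_asymp (\<lambda>q. coeff (continuant_part (A q) (B q) (C q) n i) j)
          (cexp v u w n j i) s"
        using coeff_continuant_part_asymp[of n A v B u C w n j i] assms True by blast
      from pow_asymp_lower[OF pow_asymp_cmult[OF this], of ?e "(-1) ^ i"] min[OF True False] False
      show ?thesis by simp
    qed (use False in \<open>simp add: coeff_continuant_part_eq_0\<close>)
  qed
  then have "pow_asymp (\<lambda>q. \<Sum>i\<le>n. ?f i q) ?e (\<Sum>i\<le>n. if i = m then (-1) ^ m * t else 0)"
    by (intro pow_asymp_sum)
  then have "pow_asymp (\<lambda>q. coeff (continuant (A q) (B q) (C q) n) j) ?e ((-1) ^ m * t)"
    by (rule pow_asymp_cong) (use m in \<open>simp_all add: continuant_eq_sum_parts[OF order_refl] coeff_sum\<close>)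
  with t show ?thesis by blast
qed

text \<open>The exponent is quadratic in the number of factors \<open>C\<close>; two distinct values
  of that number tie only if the second factor vanishes.\<close>

lemma cexp_diff:
  "cexp v u w n j i - cexp v u w n j m
     = (real i - real m) * (w + 2 - 2 * u + 2 * (real j + real m + real i))"
  by (simp add: cexp_def field_simps)

lemma ex_strict_min_cexp:
  assumes "j \<le> n" "w + 2 - 2 * u \<notin> (\<lambda>k. - 2 * real k) ` {1..<n}"
  shows "\<exists>m. j + 2 * m \<le> n \<and>
           (\<forall>i. j + 2 * i \<le> n \<longrightarrow> i \<noteq> m \<longrightarrow> cexp v u w n j m < cexp v u w n j i)"
proof -
  let ?S = "{m. j + 2 * m \<le> n}"
  have fin: "finite ?S" by (rule finite_subset[of _ "{..n}"]) auto
  have "0 \<in> ?S" using assms by simp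
  then obtain m where m: "m \<in> ?S" "\<And>i. i \<in> ?S \<Longrightarrow> cexp v u w n j m \<le> cexp v u w n j i"
    using arg_min_if_finite[OF fin, of "cexp v u w n j"] arg_min_least[OF fin] by blast
  have "cexp v u w n j m \<noteq> cexp v u w n j i" if "j + 2 * i \<le> n" "i \<noteq> m" for i
  proof
    assume "cexp v u w n j m = cexp v u w n j i"
    with cexp_diff[of v u w n j i m] that(2)
    have "w + 2 - 2 * u = - 2 * real (j + m + i)" by simp
    \<comment> \<open>The index \<open>j + m + i\<close> is the mean of the distinct numbers
      \<open>j + 2 * m\<close> and \<open>j + 2 * i\<close>, both at most \<open>n\<close>, hence it
      is below \<open>n\<close>; it is positive since \<open>i\<close> and \<open>m\<close>
      differ.\<close>
    moreover have "j + m + i \<in> {1..<n}" using that m(1) by auto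
    ultimately show False using assms(2) by blast
  qed
  with m show ?thesis by (force simp: less_le)
qed

section \<open>The two continuants\<close>

lemma qheun_c_eq_continuant:
  fixes h1 h2 l1 l2 \<alpha>1 \<alpha>2 \<beta> t1 t2 q :: real
  defines "mid \<equiv> qheun_mid h1 h2 l1 l2 \<alpha>1 \<alpha>2 \<beta> t1 t2 q"
    and "lhs \<equiv> qheun_lhs h1 h2 \<beta> t1 t2 q"
  shows "qheun_c h1 h2 l1 l2 \<alpha>1 \<alpha>2 \<beta> t1 t2 q n =
    continuant (\<lambda>k. coeff (mid k) 1 / lhs k) (\<lambda>k. coeff (mid k) 0 / lhs k)
      (\<lambda>k. qheun_low h1 h2 l1 l2 \<alpha>1 \<alpha>2 \<beta> q k / lhs k) n"
proof -
  let ?A = "\<lambda>k. coeff (mid k) 1 / lhs k" and ?B = "\<lambda>k. coeff (mid k) 0 / lhs k"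
  let ?C = "\<lambda>k. qheun_low h1 h2 l1 l2 \<alpha>1 \<alpha>2 \<beta> q k / lhs k"
  have mid: "[:?B k, ?A k:] = smult (1 / lhs k) (mid k)" for k
    by (simp add: mid_def qheun_mid_def Let_def)
  show ?thesis
  \<comment> \<open>The predicate ignores the three sequences, which keeps them fixed while the case
    split of \<open>continuant\<close> is used.\<close>
  proof (induction n rule: continuant.induct[of "\<lambda>_ _ _. _" ?A ?B ?C])
    case (2 A B C)
    show ?case
      by (simp only: qheun_c.simps continuant.simps mid) (simp add: mid_def lhs_def)
  next
    case (3 A B C n)
    then show ?case
      by (simp only: qheun_c.simps continuant.simps mid) (simp add: mid_def lhs_def smult_diff_right)
  qed simp
qed

text \<open>Vanishing of \<open>C\<close> at odd indices cuts the tridiagonal matrix into blocks on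
  the index pairs \<open>2 * i + 1\<close>, \<open>2 * i + 2\<close>, whose determinants are the
  factors \<open>qheun_p\<close>. For even \<open>N\<close> the last index \<open>N + 1\<close>
  forms a block of its own.\<close>

lemma qheun_c_tilde_eq_continuant:
  fixes h1 h2 l1 l2 \<alpha>1 \<alpha>2 \<beta> q v :: real and N :: nat
  defines "v \<equiv> qheun_lambda1 h1 h2 l1 l2 \<alpha>1 \<alpha>2 \<beta> - 1 - h1 - h2"
  shows "qheun_c_tilde h1 h2 l1 l2 \<alpha>1 \<alpha>2 \<beta> q N =
    continuant (\<lambda>k. q powr (v + k)) (\<lambda>k. q powr (1 / 2 - h2))
      (\<lambda>k. if even k then q powr (2 * real k + (- 1 - l1 - l2 - \<beta>)) else 0) (N + 1)"
proof -
  define K where "K = continuant (\<lambda>k. q powr (v + k)) (\<lambda>k. q powr (1 / 2 - h2))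
      (\<lambda>k. if even k then q powr (2 * real k + (- 1 - l1 - l2 - \<beta>)) else 0)"
  let ?p = "qheun_p h1 h2 l1 l2 \<alpha>1 \<alpha>2 \<beta> q"
  define D where "D k = [:q powr (1 / 2 - h2), q powr (v + real k):]" for k :: nat
  have odd: "K (Suc (2 * i)) = D (Suc (2 * i)) * K (2 * i)" for i
  proof (cases i)
    case 0
    then show ?thesis by (simp add: K_def D_def)
  next
    case (Suc r)
    then show ?thesis by (simp add: K_def D_def mult.commute)
  qed
  have p: "?p (Suc i) = D (2 * i + 2) * D (Suc (2 * i))
      - [:q powr (2 * real (2 * i + 2) + (- 1 - l1 - l2 - \<beta>)):]" for i
    by (simp add: qheun_p_def D_def v_def Let_def algebra_simps)
  have step: "K (2 * i + 2) = K (Suc (2 * i)) * D (2 * i + 2)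
      - [:q powr (2 * real (2 * i + 2) + (- 1 - l1 - l2 - \<beta>)):] * K (2 * i)" for i
    by (simp add: K_def D_def)
  have even: "K (2 * i) = (\<Prod>n=1..i. ?p n)" for i
  proof (induction i)
    case 0
    show ?case by (simp add: K_def)
  next
    case (Suc i)
    have "K (2 * i + 2) = ?p (Suc i) * K (2 * i)"
      unfolding step odd p by (simp add: algebra_simps)
    with Suc show ?case by (simp add: mult.commute)
  qed
  show ?thesis
  proof (cases "odd N")
    case True
    then obtain i where "N = 2 * i + 1" by (elim oddE)
    then show ?thesis
      using even[of "Suc i"] by (simp add: qheun_c_tilde_def K_def)
  next
    case False
    then obtain i where i: "N = 2 * i" by (auto elim: evenE)
    have "[:q powr (- h2 + 1 / 2), q powr (N + qheun_lambda1 h1 h2 l1 l2 \<alpha>1 \<alpha>2 \<beta> - h1 - h2):] = D (Suc N)"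
      by (simp add: D_def v_def algebra_simps)
    with i odd[of i] even[of i] show ?thesis
      by (simp add: qheun_c_tilde_def Let_def flip: K_def del: mult_pCons_left)
  qed
qed

section \<open>Orders of the coefficients of the recurrence\<close>

lemma qheun_lhs_asymp:
  assumes "\<beta> < 1" "1 \<le> n"
  shows "pow_asymp (\<lambda>q. qheun_lhs h1 h2 \<beta> t1 t2 q n) (h1 + h2) (t1 * t2)"
  unfolding qheun_lhs_def
proof (rule pow_asymp_cong)
  \<comment> \<open>Both \<open>n\<close> and \<open>n - \<beta>\<close> are positive, so the last
    two factors tend to 1.\<close>
  show "pow_asymp (\<lambda>q. ((t1 * t2) * q powr (h1 + h2)) * (1 - q powr real n) * (1 - q powr (real n - \<beta>)))
      (h1 + h2 + 0 + 0) (t1 * t2 * 1 * 1 * 1)"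
    using assms
    by (intro pow_asymp_mult pow_asymp_cmult pow_asymp_powr pow_asymp_one_minus_powr_pos) auto
qed (simp_all add: powr_realpow)

lemma qheun_mid_asymp_1:
  "pow_asymp (\<lambda>q. coeff (qheun_mid h1 h2 l1 l2 \<alpha>1 \<alpha>2 \<beta> t1 t2 q n) 1)
     (real n - 1 + qheun_lambda1 h1 h2 l1 l2 \<alpha>1 \<alpha>2 \<beta>) 1"
  by (simp add: qheun_mid_def Let_def pow_asymp_powr)

lemma pow_asymp_two_powr:
  "a < b \<Longrightarrow> pow_asymp (\<lambda>q. q powr a * s + q powr b * t) a s"
  using pow_asymp_add_dominant[OF pow_asymp_cmult[OF pow_asymp_powr] pow_asymp_cmult[OF pow_asymp_powr],
      of a b s t]
  by (simp add: mult.commute)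

text \<open>The order of the second summand exceeds \<open>1 / 2 + h1\<close> by
  \<open>h2 - l2 - \<beta> + 2 * n - 1\<close>, which is at least
  \<open>1 + h2 - l2 - \<beta>\<close>.\<close>

lemma qheun_mid_asymp_0:
  assumes "h1 < h2" "l1 < l2" "1 + h2 - l2 - \<beta> > 0" "1 \<le> n"
  shows "pow_asymp (\<lambda>q. coeff (qheun_mid h1 h2 l1 l2 \<alpha>1 \<alpha>2 \<beta> t1 t2 q n) 0) (1 / 2 + h1) t1"
proof -
  let ?r = "2 * (real n + qheun_lambda1 h1 h2 l1 l2 \<alpha>1 \<alpha>2 \<beta>) + \<alpha>1 + \<alpha>2 - 5 / 2"
  have "pow_asymp (\<lambda>q. q powr (1 / 2) * (q powr h1 * t1 + q powr h2 * t2)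
          + (q powr l1 * t1 + q powr l2 * t2) * q powr ?r) (1 / 2 + h1) (1 * t1)"
  proof (rule pow_asymp_add_dominant)
    show "pow_asymp (\<lambda>q. q powr (1 / 2) * (q powr h1 * t1 + q powr h2 * t2)) (1 / 2 + h1) (1 * t1)"
      by (intro pow_asymp_mult pow_asymp_powr pow_asymp_two_powr assms)
    show "pow_asymp (\<lambda>q. (q powr l1 * t1 + q powr l2 * t2) * q powr ?r) (l1 + ?r) (t1 * 1)"
      by (intro pow_asymp_mult pow_asymp_powr pow_asymp_two_powr assms)
    have "?r = h1 + h2 - l1 - l2 - \<beta> + 2 * real n - 1 / 2"
      by (simp add: qheun_lambda1_def field_simps)
    then show "1 / 2 + h1 < l1 + ?r"
      using assms by linarith
  qed
  then show ?thesis by (simp add: qheun_mid_def Let_def)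
qed

text \<open>The exponents in the brackets are \<open>n - 2 - N\<close> and that number plus
  \<open>\<alpha>2 - \<alpha>1\<close>. Both are negative for \<open>n \<le> N + 1\<close>, so the
  powers dominate and their two minus signs cancel.\<close>

lemma qheun_low_asymp:
  assumes "real N = - qheun_lambda1 h1 h2 l1 l2 \<alpha>1 \<alpha>2 \<beta> - \<alpha>1" "\<alpha>2 - \<alpha>1 < 1" "n \<le> N + 1"
  shows "pow_asymp (\<lambda>q. qheun_low h1 h2 l1 l2 \<alpha>1 \<alpha>2 \<beta> q n)
           (2 * n - 1 + h1 + h2 - l1 - l2 - \<beta>) 1"
proof -
  let ?L = "qheun_lambda1 h1 h2 l1 l2 \<alpha>1 \<alpha>2 \<beta>"
  let ?x = "real n - 2 + ?L + \<alpha>1" and ?y = "real n - 2 + ?L + \<alpha>2"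
  have "pow_asymp (\<lambda>q. q powr 1 * (1 - q powr ?x) * (1 - q powr ?y)) (1 + ?x + ?y) (1 * (-1) * (-1))"
    using assms by (intro pow_asymp_mult pow_asymp_powr pow_asymp_one_minus_powr_neg) auto
  then show ?thesis
    by (rule pow_asymp_cong) (simp_all add: qheun_low_def Let_def qheun_lambda1_def field_simps)
qed

theorem theorem3p3:
  fixes h1 h2 l1 l2 \<alpha>1 \<alpha>2 \<beta> t1 t2 :: real and N :: nat
  assumes "real N = - qheun_lambda1 h1 h2 l1 l2 \<alpha>1 \<alpha>2 \<beta> - \<alpha>1"
    and "\<beta> < 1" and "\<alpha>2 - \<alpha>1 < 1"
    and "t1 > 0" and "t2 > 0"
    and "h1 < h2" and "l1 < l2"
    and "1 + h2 - l2 - \<beta> > 0"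
    and "2 * h2 - l1 - l2 - \<beta> \<notin> (\<lambda>k. - 2 * real k) ` {1..N}"
  shows "q_approx_poly (N + 1)
           (\<lambda>q. qheun_c h1 h2 l1 l2 \<alpha>1 \<alpha>2 \<beta> t1 t2 q (N + 1))
           (\<lambda>q. qheun_c_tilde h1 h2 l1 l2 \<alpha>1 \<alpha>2 \<beta> q N)"
proof -
  \<comment> \<open>These are the exponents left after division by \<open>qheun_lhs\<close>, which
    has order \<open>h1 + h2\<close>.\<close>
  define v where "v = qheun_lambda1 h1 h2 l1 l2 \<alpha>1 \<alpha>2 \<beta> - 1 - h1 - h2"
  define u where "u = 1 / 2 - h2"
  define w where "w = - 1 - l1 - l2 - \<beta>"
  note [simp] = v_def u_def w_def
  let ?c = "\<lambda>q. qheun_c h1 h2 l1 l2 \<alpha>1 \<alpha>2 \<beta> t1 t2 q (N + 1)"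
  let ?ct = "\<lambda>q. qheun_c_tilde h1 h2 l1 l2 \<alpha>1 \<alpha>2 \<beta> q N"
  let ?mid = "\<lambda>q. qheun_mid h1 h2 l1 l2 \<alpha>1 \<alpha>2 \<beta> t1 t2 q"
  let ?lhs = "\<lambda>q. qheun_lhs h1 h2 \<beta> t1 t2 q"
  let ?low = "\<lambda>q. qheun_low h1 h2 l1 l2 \<alpha>1 \<alpha>2 \<beta> q"
  have "q_approx (\<lambda>q. coeff (?c q) j) (\<lambda>q. coeff (?ct q) j)" if j: "j \<le> N + 1" for j
  proof -
    \<comment> \<open>Since \<open>w + 2 - 2 * u\<close> equals
      \<open>2 * h2 - l1 - l2 - \<beta>\<close>, this is the last hypothesis.\<close>
    have "w + 2 - 2 * u \<notin> (\<lambda>k. - 2 * real k) ` {1..<N + 1}"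
      using assms(9) by (simp add: atLeastLessThanSuc_atLeastAtMost algebra_simps)
    \<comment> \<open>The minimiser depends only on the exponents, so the same \<open>m\<close>
      serves both polynomials.\<close>
    then obtain m where m: "j + 2 * m \<le> N + 1"
      "\<And>i. j + 2 * i \<le> N + 1 \<Longrightarrow> i \<noteq> m \<Longrightarrow> cexp v u w (N + 1) j m < cexp v u w (N + 1) j i"
      using ex_strict_min_cexp[OF j, of w u v] by blast
    have "\<exists>s>0. pow_asymp (\<lambda>q. coeff (?c q) j) (cexp v u w (N + 1) j m) ((-1) ^ m * s)"
      unfolding qheun_c_eq_continuant
    proof (rule coeff_continuant_asymp[OF _ _ _ m])
      fix k assume k: "k \<in> {1..N + 1}"
      then have lhs: "pow_asymp (\<lambda>q. ?lhs q k) (h1 + h2) (t1 * t2)" and nz: "t1 * t2 \<noteq> 0"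
        using qheun_lhs_asymp assms by auto
      have "pow_asymp (\<lambda>q. coeff (?mid q k) 1 / ?lhs q k) (v + k) (1 / (t1 * t2))"
        using pow_asymp_divide[OF qheun_mid_asymp_1[of h1 h2 l1 l2 \<alpha>1 \<alpha>2 \<beta> t1 t2 k] lhs nz]
        by (rule pow_asymp_cong) simp_all
      then show "\<exists>a>0. pow_asymp (\<lambda>q. coeff (?mid q k) 1 / ?lhs q k) (v + k) a"
        using assms by (intro exI[of _ "1 / (t1 * t2)"]) simp
      have "pow_asymp (\<lambda>q. coeff (?mid q k) 0 / ?lhs q k) u (t1 / (t1 * t2))"
        using pow_asymp_divide[OF qheun_mid_asymp_0[OF assms(6-8), of k \<alpha>1 \<alpha>2 t1 t2] lhs nz]
        by (rule pow_asymp_cong) (use k in simp_all)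
      then show "\<exists>b>0. pow_asymp (\<lambda>q. coeff (?mid q k) 0 / ?lhs q k) u b"
        using assms by (intro exI[of _ "t1 / (t1 * t2)"]) simp
    next
      fix k assume k: "k \<in> {2..N + 1}"
      then have lhs: "pow_asymp (\<lambda>q. ?lhs q k) (h1 + h2) (t1 * t2)" and nz: "t1 * t2 \<noteq> 0"
        using qheun_lhs_asymp assms by auto
      have "pow_asymp (\<lambda>q. ?low q k / ?lhs q k) (2 * real k + w) (1 / (t1 * t2))"
        using pow_asymp_divide[OF qheun_low_asymp[OF assms(1,3), of k] lhs nz]
        by (rule pow_asymp_cong) (use k in simp_all)
      then show "\<exists>c\<ge>0. (even k \<longrightarrow> c > 0) \<and> pow_asymp (\<lambda>q. ?low q k / ?lhs q k) (2 * real k + w) c"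
        using assms by (intro exI[of _ "1 / (t1 * t2)"]) simp
    qed
    moreover have "\<exists>s>0. pow_asymp (\<lambda>q. coeff (?ct q) j) (cexp v u w (N + 1) j m) ((-1) ^ m * s)"
      unfolding qheun_c_tilde_eq_continuant v_def[symmetric] u_def[symmetric] w_def[symmetric]
    proof (rule coeff_continuant_asymp[OF _ _ _ m])
      fix k assume "k \<in> {2..N + 1}"
      show "\<exists>c\<ge>0. (even k \<longrightarrow> c > 0) \<and>
          pow_asymp (\<lambda>q. if even k then q powr (2 * real k + w) else 0) (2 * real k + w) c"
        using pow_asymp_powr[of "2 * real k + w"]
        by (intro exI[of _ "if even k then 1 else 0"]) (simp del: w_def)
    qed (use pow_asymp_powr zero_less_one in blast)+
    ultimately obtain s t where "s > 0" "t > 0"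
      "pow_asymp (\<lambda>q. coeff (?c q) j) (cexp v u w (N + 1) j m) ((-1) ^ m * s)"
      "pow_asymp (\<lambda>q. coeff (?ct q) j) (cexp v u w (N + 1) j m) ((-1) ^ m * t)"
      by blast
    \<comment> \<open>The common sign \<open>(-1) ^ m\<close> cancels, leaving the positive ratio
      \<open>s / t\<close>.\<close>
    then show ?thesis by (intro q_approx_pow_asymp) auto
  qed
  then show ?thesis
    unfolding q_approx_poly_def
    by (simp add: qheun_c_eq_continuant qheun_c_tilde_eq_continuant degree_continuant
        del: continuant.simps)
qed

end
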